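(* Consider an ontological model of a quantum system $S$ with ontic space $\Lambda$. Let $\{\Pi_{E_i}\}_i$ be a complete family of mutually orthogonal projectors on the Hilbert space of $S$, i.e. $\Pi_{E_i}\Pi_{E_j}=0$ for $i\neq j$ and $\sum_i\Pi_{E_i}=1$, and let $M$ be a measurement setting in which this family is jointly measured and which is outcome deterministic, i.e. $\xi_{E_i}(\lambda,M)^2=\xi_{E_i}(\lambda,M)$ for all $i$ and all $\lambda\in\Lambda$. Then for all $i\neq j$ $$\mathrm{Supp}(\xi_{E_i}(\cdot,M))\cap\mathrm{Supp}(\xi_{E_j}(\cdot,M))=\emptyset .$$
   Context: An ontological model of a quantum system $S$ with finite-dimensional complex Hilbert space $H$ consists of a measure space $\Lambda$ (the ontic space, whose points $\lambda$ are ontic states; integration is written $d\lambda$) together with the following data. (1) For each pure state (unit vector) $\psi \in H$ and each preparation setting $P$ for $\psi$, a probability density $\rho(\lambda|\psi,P)\ge 0$ on $\Lambda$. (2) For each POVM $\{E_i\}$ (finitely many positive operators with $\sum_i E_i = 1$; in particular a complete family of mutually orthogonal projectors) a nonempty set of measurement settings $M$ implementing it, and for each such $M$ measurable indicator (response) functions $\xi_{E_i}(\cdot,M):\Lambda\to[0,1]$ satisfying the normalization $\sum_i \xi_{E_i}(\lambda,M)=1$ for every $\lambda\in\Lambda$. (3) Born's rule is reproduced: for every POVM $\{E_i\}$, every setting $M$ implementing it, every pure state $\psi$ and every preparation setting $P$ for $\psi$, $\int d\lambda\,\xi_{E_i}(\lambda,M)\rho(\lambda|\psi,P)=\langle\psi|E_i|\psi\rangle$.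 The support of a function is the set where it is nonzero. *)

theory Defs
  imports "HOL-Analysis.Analysis"
begin

text \<open>
  The Hilbert space is \<open>complex^'n\<close>, whose library norm is the one induced by
  the inner product below. Operators are matrices acting by \<open>*v\<close>.
\<close>

type_synonym 'n operator = "complex^'n^'n"

definition cinner :: "complex^'n \<Rightarrow> complex^'n \<Rightarrow> complex" where
  "cinner v w = (\<Sum>k\<in>UNIV. cnj (v $ k) * w $ k)"

definition cadjoint :: "'n::finite operator \<Rightarrow> 'n operator" where
  "cadjoint A = (\<chi> i j. cnj (A $ j $ i))"

definition positive_operator :: "'n::finite operator \<Rightarrow> bool" where
  "positive_operator A \<longleftrightarrow>
     (\<forall>v. cinner v (A *v v) \<in> \<real> \<and> 0 \<le> Re (cinner v (A *v v)))"

definition projector :: "'n::finite operator \<Rightarrow> bool" where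
  "projector A \<longleftrightarrow> cadjoint A = A \<and> A ** A = A"

text \<open>
  A finite family of operators is a list, so that repeated (for instance zero)
  members are distinguished by their index.
\<close>

definition povm :: "'n::finite operator list \<Rightarrow> bool" where
  "povm E \<longleftrightarrow>
     (\<forall>i<length E. positive_operator (E ! i)) \<and> (\<Sum>i<length E. E ! i) = mat 1"

definition complete_orthogonal_projectors :: "'n::finite operator list \<Rightarrow> bool" where
  "complete_orthogonal_projectors E \<longleftrightarrow>
     (\<forall>i<length E. projector (E ! i)) \<and>
     (\<forall>i<length E. \<forall>j<length E. i \<noteq> j \<longrightarrow> E ! i ** E ! j = 0) \<and>
     (\<Sum>i<length E. E ! i) = mat 1"

text \<open>
  \<open>preps \<psi>\<close> and \<open>meas E\<close> are the settings preparing the pure state \<open>\<psi>\<close> and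
  implementing the POVM \<open>E\<close>; \<open>\<rho> \<psi> P l\<close> is the density and \<open>\<xi> E i M l\<close> the response
  function of the \<open>i\<close>-th outcome of \<open>E\<close>. As \<open>\<xi>\<close> takes the whole family and the index,
  it need not be determined by the single effect \<open>E ! i\<close> and the setting \<open>M\<close>.
\<close>

locale ontological_model =
  fixes \<Lambda> :: "'l measure"
    and preps :: "complex^('n::finite) \<Rightarrow> 'p set"
    and \<rho> :: "complex^'n \<Rightarrow> 'p \<Rightarrow> 'l \<Rightarrow> real"
    and meas :: "'n operator list \<Rightarrow> 'm set"
    and \<xi> :: "'n operator list \<Rightarrow> nat \<Rightarrow> 'm \<Rightarrow> 'l \<Rightarrow> real"
  assumes density_nonneg:
      "\<And>\<psi> P l. norm \<psi> = 1 \<Longrightarrow> P \<in> preps \<psi> \<Longrightarrow> l \<in> space \<Lambda> \<Longrightarrow> 0 \<le> \<rho> \<psi> P l"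
    and density_normalized:
      "\<And>\<psi> P. norm \<psi> = 1 \<Longrightarrow> P \<in> preps \<psi> \<Longrightarrow> has_bochner_integral \<Lambda> (\<rho> \<psi> P) 1"
    and meas_nonempty:
      "\<And>E. povm E \<Longrightarrow> meas E \<noteq> {}"
    and response_measurable:
      "\<And>E M i. povm E \<Longrightarrow> M \<in> meas E \<Longrightarrow> i < length E \<Longrightarrow>
         \<xi> E i M \<in> borel_measurable \<Lambda>"
    and response_range:
      "\<And>E M i l. povm E \<Longrightarrow> M \<in> meas E \<Longrightarrow> i < length E \<Longrightarrow> l \<in> space \<Lambda> \<Longrightarrow>
         \<xi> E i M l \<in> {0..1}"
    and response_normalized:
      "\<And>E M l. povm E \<Longrightarrow> M \<in> meas E \<Longrightarrow> l \<in> space \<Lambda> \<Longrightarrow>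
         (\<Sum>i<length E. \<xi> E i M l) = 1"
    and born_rule:
      "\<And>E M i \<psi> P. povm E \<Longrightarrow> M \<in> meas E \<Longrightarrow> i < length E \<Longrightarrow>
         norm \<psi> = 1 \<Longrightarrow> P \<in> preps \<psi> \<Longrightarrow>
         complex_of_real (LINT l|\<Lambda>. \<xi> E i M l * \<rho> \<psi> P l) = cinner \<psi> (E ! i *v \<psi>)"

definition supp_on :: "'l measure \<Rightarrow> ('l \<Rightarrow> real) \<Rightarrow> 'l set" where
  "supp_on \<Lambda> f = {l \<in> space \<Lambda>. f l \<noteq> 0}"

end

theory Submission
  imports Defs
begin

text \<open>An outcome-deterministic response function takes only the values 0 and 1. At an ontic
  state in the supports of two distinct outcomes both responses would be 1, and since the remaining
  ones are nonnegative, the total would be at least 2, against normalization to 1. The axioms of the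
  model speak about POVMs, so the family of projectors must first be recognized as one
  (\<open>complete_orthogonal_projectors_imp_povm\<close>); this rests on the positivity of
  projectors.\<close>

lemma cinner_cadjoint: "cinner (cadjoint A *v v) w = cinner v (A *v w)"
proof -
  have "cinner (cadjoint A *v v) w = (\<Sum>k\<in>UNIV. \<Sum>j\<in>UNIV. cnj (v $ j) * (A $ j $ k * w $ k))"
    by (simp add: cinner_def cadjoint_def matrix_vector_mult_def sum_distrib_left sum_distrib_right ac_simps)
  also have "\<dots> = cinner v (A *v w)"
    by (subst sum.swap) (simp add: cinner_def matrix_vector_mult_def sum_distrib_left)
  finally show ?thesis .
qed

text \<open>Writing the value as an embedded real yields both halves of
  \<open>positive_operator\<close> at once: it is real, and its real part is a sum of
  squares.\<close>

lemma cinner_self: "cinner v v = of_real (\<Sum>k\<in>UNIV. (cmod (v $ k))\<^sup>2)"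
  unfolding cinner_def of_real_sum
  by (rule sum.cong) (simp_all add: complex_norm_square mult.commute flip: of_real_power)

text \<open>Self-adjointness and idempotence turn the quadratic form of \<open>A\<close> at
  \<open>v\<close> into the squared norm of \<open>A *v v\<close>.\<close>

lemma projector_imp_positive_operator:
  assumes "projector A"
  shows "positive_operator A"
proof -
  have "cinner v (A *v v) = cinner (A *v v) (A *v v)" for v
    using assms cinner_cadjoint[of A v "A *v v"]
    by (simp add: projector_def matrix_vector_mul_assoc)
  then show ?thesis
    by (simp add: positive_operator_def cinner_self sum_nonneg del: of_real_sum of_real_power)
qed

lemma complete_orthogonal_projectors_imp_povm:
  "complete_orthogonal_projectors E \<Longrightarrow> povm E"
  by (simp add: complete_orthogonal_projectors_def povm_def projector_imp_positive_operator)

theorem lemma3: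
  fixes \<Lambda> :: "'l measure"
    and preps :: "complex^('n::finite) \<Rightarrow> 'p set"
    and \<rho> :: "complex^'n \<Rightarrow> 'p \<Rightarrow> 'l \<Rightarrow> real"
    and meas :: "'n operator list \<Rightarrow> 'm set"
    and \<xi> :: "'n operator list \<Rightarrow> nat \<Rightarrow> 'm \<Rightarrow> 'l \<Rightarrow> real"
    and E :: "'n operator list"
    and M :: 'm
  assumes "ontological_model \<Lambda> preps \<rho> meas \<xi>"
    and "complete_orthogonal_projectors E"
    and "M \<in> meas E"
    and "\<forall>i<length E. \<forall>l\<in>space \<Lambda>. (\<xi> E i M l)\<^sup>2 = \<xi> E i M l"
  shows "\<forall>i<length E. \<forall>j<length E. i \<noteq> j \<longrightarrow>
           supp_on \<Lambda> (\<xi> E i M) \<inter> supp_on \<Lambda> (\<xi> E j M) = {}"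
proof (intro allI impI, rule ccontr)
  fix i j
  assume i: "i < length E" and j: "j < length E" and ne: "i \<noteq> j"
    and "supp_on \<Lambda> (\<xi> E i M) \<inter> supp_on \<Lambda> (\<xi> E j M) \<noteq> {}"
  then obtain l where l: "l \<in> space \<Lambda>" and nz: "\<xi> E i M l \<noteq> 0" "\<xi> E j M l \<noteq> 0"
    by (auto simp: supp_on_def)
  have povm: "povm E"
    using assms(2) by (rule complete_orthogonal_projectors_imp_povm)
  \<comment> \<open>Determinism: a nonzero real equal to its square is 1.\<close>
  have one: "\<xi> E i M l = 1" "\<xi> E j M l = 1"
    using assms(4)[rule_format, OF i l] assms(4)[rule_format, OF j l] nz
    by (simp_all add: power2_eq_square)
  have nonneg: "0 \<le> \<xi> E k M l" if "k < length E" for k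
    using ontological_model.response_range[OF assms(1) povm assms(3) that l] by simp
  \<comment> \<open>As \<open>i\<close> and \<open>j\<close> differ, the left-hand sum has two terms
    and equals 2; the terms omitted from the full sum are nonnegative.\<close>
  have "(\<Sum>k\<in>{i, j}. \<xi> E k M l) \<le> (\<Sum>k<length E. \<xi> E k M l)"
    by (rule sum_mono2) (use i j nonneg in auto)
  also have "\<dots> = 1"
    by (rule ontological_model.response_normalized[OF assms(1) povm assms(3) l])
  finally show False
    using ne one by simp
qed

end
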